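(* Let $(G,\sigma)$ be a connected signed graph with a fixed orientation $\tau$. If $(G,\sigma)$ admits a modulo $2$-flow $f_1$ such that $\mathrm{supp}(f_1)$ contains an even number of negative edges, then $(G,\sigma)$ also admits an integer-valued $3$-flow $f_2$ with $\mathrm{supp}(f_1)=\{e\in E(G)\colon f_2(e)=\pm 1\}$.
   Context: Graphs may have multiple edges and loops. A signed graph $(G,\sigma)$ is a graph $G$ with a signature $\sigma\colon E(G)\to\{\pm1\}$; an edge $e$ is positive if $\sigma(e)=1$ and negative otherwise. Each edge consists of two half-edges, each incident with exactly one end of the edge; $H(v)$ denotes the set of half-edges incident with $v$, $H(G)=\bigcup_v H(v)$, and $e_h$ is the edge containing half-edge $h$. An orientation of $(G,\sigma)$ is a map $\tau\colon H(G)\to\{\pm1\}$ with $\tau(h_1)\tau(h_2)=-\sigma(e)$ for every edge $e$ with half-edges $h_1,h_2$. For a positive integer $k$ and a map $f\colon E(G)\to\mathbb{Z}$ with $0\le |f(e)|\le k-1$ for all $e$, the boundary of $f$ at $v$ is $\partial f(v)=\sum_{h\in H(v)} f(e_h)\tau(h)$. Such $f$ is an integer-valued $k$-flow if $\partial f(v)=0$ for all $v$, and a modulo $k$-flow if $\partial f(v)\equiv 0\pmod k$ for all $v$. The support is $\mathrm{supp}(f)=\{e\colon f(e)\neq 0\}$. *)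

theory Defs
  imports Main "HOL-Number_Theory.Cong"
begin

text \<open>Half-edges are primitive objects, so loops and multiple edges need no special treatment:
  a loop is an edge whose two half-edges have the same end.\<close>

record ('v, 'e, 'h) multigraph =
  vertices :: "'v set"
  edges :: "'e set"
  halfedges :: "'h set"
  edge_of :: "'h \<Rightarrow> 'e"
  end_of :: "'h \<Rightarrow> 'v"

locale finite_multigraph =
  fixes G :: "('v, 'e, 'h) multigraph" (structure)
  assumes finite_vertices: "finite (vertices G)"
    and finite_edges: "finite (edges G)"
    and edge_of_in: "h \<in> halfedges G \<Longrightarrow> edge_of G h \<in> edges G"
    and end_of_in: "h \<in> halfedges G \<Longrightarrow> end_of G h \<in> vertices G"
    and two_halfedges: "e \<in> edges G \<Longrightarrow> card {h \<in> halfedges G. edge_of G h = e} = 2"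

definition halfedges_at :: "('v, 'e, 'h) multigraph \<Rightarrow> 'v \<Rightarrow> 'h set" where
  "halfedges_at G v = {h \<in> halfedges G. end_of G h = v}"

definition adjacency :: "('v, 'e, 'h) multigraph \<Rightarrow> ('v \<times> 'v) set" where
  "adjacency G = {(end_of G h, end_of G h') |h h'.
     h \<in> halfedges G \<and> h' \<in> halfedges G \<and> h \<noteq> h' \<and> edge_of G h = edge_of G h'}"

definition connected_multigraph :: "('v, 'e, 'h) multigraph \<Rightarrow> bool" where
  "connected_multigraph G \<longleftrightarrow> vertices G \<noteq> {} \<and>
     (\<forall>u \<in> vertices G. \<forall>v \<in> vertices G. (u, v) \<in> (adjacency G)\<^sup>*)"

definition signature :: "('v, 'e, 'h) multigraph \<Rightarrow> ('e \<Rightarrow> int) \<Rightarrow> bool" where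
  "signature G \<sigma> \<longleftrightarrow> (\<forall>e \<in> edges G. \<sigma> e \<in> {1, -1})"

definition negative_edges :: "('v, 'e, 'h) multigraph \<Rightarrow> ('e \<Rightarrow> int) \<Rightarrow> 'e set" where
  "negative_edges G \<sigma> = {e \<in> edges G. \<sigma> e = -1}"

definition orientation ::
  "('v, 'e, 'h) multigraph \<Rightarrow> ('e \<Rightarrow> int) \<Rightarrow> ('h \<Rightarrow> int) \<Rightarrow> bool" where
  "orientation G \<sigma> \<tau> \<longleftrightarrow> (\<forall>h \<in> halfedges G. \<tau> h \<in> {1, -1}) \<and>
     (\<forall>h \<in> halfedges G. \<forall>h' \<in> halfedges G.
        h \<noteq> h' \<and> edge_of G h = edge_of G h' \<longrightarrow> \<tau> h * \<tau> h' = - \<sigma> (edge_of G h))"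

definition boundary ::
  "('v, 'e, 'h) multigraph \<Rightarrow> ('h \<Rightarrow> int) \<Rightarrow> ('e \<Rightarrow> int) \<Rightarrow> 'v \<Rightarrow> int" where
  "boundary G \<tau> f v = (\<Sum>h \<in> halfedges_at G v. f (edge_of G h) * \<tau> h)"

definition integer_flow ::
  "('v, 'e, 'h) multigraph \<Rightarrow> ('h \<Rightarrow> int) \<Rightarrow> nat \<Rightarrow> ('e \<Rightarrow> int) \<Rightarrow> bool" where
  "integer_flow G \<tau> k f \<longleftrightarrow> (\<forall>e \<in> edges G. \<bar>f e\<bar> \<le> int k - 1) \<and>
     (\<forall>v \<in> vertices G. boundary G \<tau> f v = 0)"

definition modulo_flow ::
  "('v, 'e, 'h) multigraph \<Rightarrow> ('h \<Rightarrow> int) \<Rightarrow> nat \<Rightarrow> ('e \<Rightarrow> int) \<Rightarrow> bool" where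
  "modulo_flow G \<tau> k f \<longleftrightarrow> (\<forall>e \<in> edges G. \<bar>f e\<bar> \<le> int k - 1) \<and>
     (\<forall>v \<in> vertices G. [boundary G \<tau> f v = 0] (mod int k))"

definition flow_support :: "('v, 'e, 'h) multigraph \<Rightarrow> ('e \<Rightarrow> int) \<Rightarrow> 'e set" where
  "flow_support G f = {e \<in> edges G. f e \<noteq> 0}"

end

theory Submission imports Defs begin

text \<open>
  More generally, for every root \<open>r\<close> there is an \<open>f\<close> with \<open>\<bar>f\<bar> \<le> 2\<close>, odd exactly on
  \<open>H = supp f\<^sub>1\<close>, whose boundary lies in \<open>{-2, 0, 2}\<close> everywhere and is prescribed modulo 4 (by
  any even-valued \<open>D\<close>) at all vertices but \<open>r\<close>. Order the vertices so that each one but \<open>r\<close> is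
  adjacent to an earlier one, and eliminate the last vertex \<open>v\<close>. A loop in \<open>H\<close> is removed at the
  price of changing \<open>D\<close> at its end. Two edges of \<open>H\<close> at \<open>v\<close> are merged into one edge joining
  their other ends, whose sign decides whether they contribute 0 or \<open>\<plusminus>2\<close> at \<open>v\<close>. An edge outside
  \<open>H\<close> is deleted, unless it is the last edge at \<open>v\<close>; then it carries \<open>D v\<close> over to its other end.

  For \<open>D = 0\<close> the boundary vanishes except possibly at \<open>r\<close>. As the sum of all boundaries is
  congruent to twice the number of negative edges in \<open>H\<close> modulo 4, it vanishes at \<open>r\<close> as well.
\<close>

text \<open>The signed incidence column of an edge with ends \<open>x\<close>, \<open>y\<close> and half-edge orientations
  \<open>a\<close>, \<open>b\<close>. Only these columns enter the argument, so edges can be merged by changing the matrix.\<close>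

definition col :: "'v \<Rightarrow> int \<Rightarrow> 'v \<Rightarrow> int \<Rightarrow> 'v \<Rightarrow> int" where
  "col x a y b = (\<lambda>v. (if v = x then a else 0) + (if v = y then b else 0))"

definition edge_column :: "'v set \<Rightarrow> ('v \<Rightarrow> int) \<Rightarrow> bool" where
  "edge_column V c \<longleftrightarrow> (\<exists>x\<in>V. \<exists>y\<in>V. \<exists>a\<in>{1, -1}. \<exists>b\<in>{1, -1}. c = col x a y b)"

text \<open>A positive loop has the zero column, whatever its end; a negative loop has the single
  entry 2 or -2.\<close>

definition loop_column :: "'v set \<Rightarrow> ('v \<Rightarrow> int) \<Rightarrow> bool" where
  "loop_column V c \<longleftrightarrow> (\<exists>x\<in>V. \<exists>a\<in>{1, -1}. \<exists>b\<in>{1, -1}. c = col x a x b)"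

definition net_flow :: "'e set \<Rightarrow> ('e \<Rightarrow> 'v \<Rightarrow> int) \<Rightarrow> ('e \<Rightarrow> int) \<Rightarrow> 'v \<Rightarrow> int" where
  "net_flow E M f v = (\<Sum>e\<in>E. f e * M e v)"

text \<open>For distinct vertices and an edge column, two nonzero entries sit exactly at the two
  ends, so adjacency can be read off the matrix alone.\<close>

definition joined :: "'e set \<Rightarrow> ('e \<Rightarrow> 'v \<Rightarrow> int) \<Rightarrow> 'v \<Rightarrow> 'v \<Rightarrow> bool" where
  "joined E M v w \<longleftrightarrow> (\<exists>e\<in>E. M e v \<noteq> 0 \<and> M e w \<noteq> 0)"

text \<open>The list is in reverse order of attachment: its head is the vertex attached last.\<close>

fun attached :: "('v \<Rightarrow> 'v \<Rightarrow> bool) \<Rightarrow> 'v \<Rightarrow> 'v list \<Rightarrow> bool" where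
  "attached A r [] = True"
| "attached A r (v # xs) =
    (v \<notin> insert r (set xs) \<and> (\<exists>y\<in>insert r (set xs). A v y) \<and> attached A r xs)"

text \<open>The entries of a non-loop column are odd exactly at its ends, and those of a loop are
  all even. The parity condition thus says that \<open>H\<close> has even degree at every
  vertex.\<close>

definition even_system ::
  "'v \<Rightarrow> 'v list \<Rightarrow> 'e set \<Rightarrow> ('e \<Rightarrow> 'v \<Rightarrow> int) \<Rightarrow> 'e set \<Rightarrow> bool" where
  "even_system r xs E M H \<longleftrightarrow> finite E \<and> H \<subseteq> E \<and>
     (\<forall>e\<in>E. edge_column (insert r (set xs)) (M e)) \<and>
     (\<forall>v\<in>insert r (set xs). even (net_flow H M (\<lambda>_. 1) v)) \<and>
     attached (joined E M) r xs"

text \<open>Prescribing values only modulo 4 leaves the sign of a 2 free, which is what the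
  extension steps exploit. No residue is prescribed at \<open>r\<close>, because in an even system
  the residues elsewhere already determine it.\<close>

definition solution ::
  "'v \<Rightarrow> 'v list \<Rightarrow> 'e set \<Rightarrow> ('e \<Rightarrow> 'v \<Rightarrow> int) \<Rightarrow> 'e set \<Rightarrow> ('v \<Rightarrow> int) \<Rightarrow> ('e \<Rightarrow> int) \<Rightarrow> bool" where
  "solution r xs E M H D f \<longleftrightarrow>
     (\<forall>e\<in>E. \<bar>f e\<bar> \<le> 2 \<and> (odd (f e) \<longleftrightarrow> e \<in> H)) \<and>
     (\<forall>v\<in>insert r (set xs). net_flow E M f v \<in> {-2, 0, 2}) \<and>
     (\<forall>v\<in>set xs. 4 dvd net_flow E M f v - D v)"

section \<open>Attachment orders of the vertices\<close>

lemma attached_mono: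
  assumes "attached A r xs"
    and "\<And>v y. v \<in> set xs \<Longrightarrow> y \<in> insert r (set xs) \<Longrightarrow> v \<noteq> y \<Longrightarrow> A v y \<Longrightarrow> B v y"
  shows "attached B r xs"
  using assms
proof (induction xs)
  case (Cons v xs)
  obtain y where y: "y \<in> insert r (set xs)" "A v y" and v: "v \<notin> insert r (set xs)"
    and att: "attached A r xs"
    using Cons.prems(1) by auto
  have "B v y"
    using y v by (intro Cons.prems(2)) auto
  moreover have "attached B r xs"
    by (rule Cons.IH[OF att]) (auto intro: Cons.prems(2))
  ultimately show ?case
    using y v by auto
qed simp

text \<open>Any order covering less than \<open>V\<close> can be prolonged through
  \<open>exit\<close>; the induction is on the number of uncovered vertices.\<close>

lemma exists_spanning_attached:
  assumes fin: "finite V" and r: "r \<in> V"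
    and exit: "\<And>S. S \<subset> V \<Longrightarrow> r \<in> S \<Longrightarrow> \<exists>v\<in>V - S. \<exists>y\<in>S. A v y"
  shows "\<exists>xs. attached A r xs \<and> insert r (set xs) = V"
proof -
  have "\<exists>ys. attached A r ys \<and> insert r (set ys) = V"
    if "attached A r xs" "insert r (set xs) \<subseteq> V" for xs
    using that
  proof (induction "card (V - insert r (set xs))" arbitrary: xs rule: less_induct)
    case less
    show ?case
    proof (cases "insert r (set xs) = V")
      case False
      then obtain v y where v: "v \<in> V - insert r (set xs)" and y: "y \<in> insert r (set xs)" "A v y"
        using exit[of "insert r (set xs)"] less.prems by blast
      have "V - insert r (set (v # xs)) \<subset> V - insert r (set xs)"
        using v by auto
      then have "card (V - insert r (set (v # xs))) < card (V - insert r (set xs))"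
        using fin by (intro psubset_card_mono) auto
      moreover have "attached A r (v # xs)"
        using v y less.prems by auto
      moreover have "insert r (set (v # xs)) \<subseteq> V"
        using v less.prems by auto
      ultimately show ?thesis
        using less.hyps by blast
    qed (use less in blast)
  qed
  from this[of "[]"] show ?thesis
    using r by simp
qed

section \<open>Edge columns and net flows\<close>

lemma edge_column_at:
  assumes "edge_column V c" "c v \<noteq> 0"
  shows "\<exists>x\<in>V. \<exists>a\<in>{1, -1}. \<exists>b\<in>{1, -1}. c = col v a x b"
proof -
  obtain x y a b where *: "x \<in> V" "y \<in> V" "a \<in> {1, -1}" "b \<in> {1, -1}" "c = col x a y b"
    using assms(1) unfolding edge_column_def by blast
  then consider "v = x" | "v = y"
    using assms(2) by (auto simp: col_def split: if_splits)
  then show ?thesis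
  proof cases
    case 1
    then show ?thesis using * by blast
  next
    case 2
    have "c = col y b x a"
      using * by (auto simp: col_def)
    then show ?thesis using 2 * by blast
  qed
qed

lemma edge_column_col:
  "x \<in> V \<Longrightarrow> y \<in> V \<Longrightarrow> a \<in> {1, -1} \<Longrightarrow> b \<in> {1, -1} \<Longrightarrow> edge_column V (col x a y b)"
  unfolding edge_column_def by blast

lemma net_flow_remove:
  assumes "finite E" "e \<in> E"
  shows "net_flow E M f v = f e * M e v + net_flow (E - {e}) M f v"
  unfolding net_flow_def by (rule sum.remove[OF assms])

lemma net_flow_cong:
  assumes "\<And>e. e \<in> E \<Longrightarrow> f e = g e" "\<And>e. e \<in> E \<Longrightarrow> M e v = N e v"
  shows "net_flow E M f v = net_flow E N g v"
  unfolding net_flow_def by (rule sum.cong) (simp_all add: assms)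

lemma net_flow_upd [simp]:
  "e \<notin> E \<Longrightarrow> net_flow E M (f(e := s)) v = net_flow E M f v"
  by (rule net_flow_cong) auto

section \<open>Removing and restoring loops\<close>

lemma even_system_remove_loop:
  assumes sys: "even_system r xs E M H" and e: "e \<in> E" and M: "M e = col x a x b"
    and ab: "a \<in> {1, -1}" "b \<in> {1, -1}"
  shows "even_system r xs (E - {e}) M (H - {e})"
proof -
  have fin: "finite E" "finite H"
    using sys finite_subset unfolding even_system_def by auto
  have "even (net_flow (H - {e}) M (\<lambda>_. 1) v)" if v: "v \<in> insert r (set xs)" for v
  proof (cases "e \<in> H")
    case True
    have "even (net_flow H M (\<lambda>_. 1) v)"
      using sys v unfolding even_system_def by blast
    moreover have "even (M e v)"
      using ab by (auto simp: M col_def)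
    ultimately show ?thesis
      unfolding net_flow_remove[OF fin(2) True] by simp
  next
    case False
    then have "H - {e} = H"
      by simp
    then show ?thesis
      using sys v unfolding even_system_def by metis
  qed
  \<comment> \<open>A loop column has at most one nonzero entry, so it joins no two distinct
    vertices.\<close>
  moreover have "attached (joined (E - {e}) M) r xs"
    by (rule attached_mono[of "joined E M"])
      (use sys M in \<open>auto simp: even_system_def joined_def col_def split: if_splits\<close>)
  ultimately show ?thesis
    using sys unfolding even_system_def by auto
qed

text \<open>The loop changes the boundary at \<open>x\<close> only, by \<open>s * (a + b)\<close>.
  As \<open>a + b\<close> is even, both signs of \<open>s\<close> give the same residue modulo 4,
  which the shift of \<open>D x\<close> anticipates, and the sign can be spent on keeping the
  boundary small.\<close>

lemma solution_add_loop:
  assumes sys: "even_system r xs E M H" and e: "e \<in> E" and M: "M e = col x a x b"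
    and ab: "a \<in> {1, -1}" "b \<in> {1, -1}" and x: "x \<in> insert r (set xs)"
    and sol: "solution r xs (E - {e}) M (H - {e}) (D(x := D x + (if e \<in> H then a + b else 0))) f"
  shows "\<exists>g. solution r xs E M H D g"
proof -
  have fin: "finite E"
    using sys unfolding even_system_def by auto
  define S where "S = net_flow (E - {e}) M f x"
  have S: "S \<in> {-2, 0, 2}"
    using sol x unfolding S_def solution_def by blast
  have Mv: "M e v = (if v = x then a + b else 0)" for v
    by (simp add: M col_def)
  \<comment> \<open>Both \<open>S\<close> and \<open>a + b\<close> lie in {-2, 0, 2}, so adding or
    subtracting stays in this set for at least one choice.\<close>
  obtain s :: int where s: "\<bar>s\<bar> \<le> 1" "odd s \<longleftrightarrow> e \<in> H" "S + s * (a + b) \<in> {-2, 0, 2}"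
  proof (cases "e \<in> H")
    case True
    have "S + (a + b) \<in> {-2, 0, 2} \<or> S - (a + b) \<in> {-2, 0, 2}"
      using S ab by auto
    then show ?thesis
      using True that[of 1] that[of "-1"] by auto
  next
    case False
    then show ?thesis
      using S that[of 0] by auto
  qed
  have mod: "4 dvd S + s * (a + b) - D x" if "x \<in> set xs"
  proof -
    have "4 dvd S - (D x + (if e \<in> H then a + b else 0))"
      using sol that unfolding solution_def S_def by auto
    moreover have "s = 0 \<and> e \<notin> H \<or> (s = 1 \<or> s = -1) \<and> e \<in> H"
      using s by (cases "s = 0"; cases "s = 1"; cases "s = -1") auto
    ultimately show ?thesis
      using ab by (auto; presburger)
  qed
  have nf: "net_flow E M (f(e := s)) v =
      (if v = x then S + s * (a + b) else net_flow (E - {e}) M f v)" for v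
    using net_flow_remove[OF fin e, of M "f(e := s)" v] by (auto simp: Mv S_def)
  have "\<bar>s\<bar> \<le> 2"
    using s by simp
  then have "solution r xs E M H D (f(e := s))"
    using sol s(2,3) mod unfolding solution_def nf by auto
  then show ?thesis by blast
qed


section \<open>Edges at the last vertex\<close>

lemma edge_column_top:
  assumes "edge_column (insert r (set (v # ys))) c" "\<not> loop_column (insert r (set (v # ys))) c"
    and "c v \<noteq> 0"
  shows "\<exists>x\<in>insert r (set ys). \<exists>a\<in>{1, -1}. \<exists>b\<in>{1, -1}. x \<noteq> v \<and> c = col v a x b"
proof -
  obtain x a b where *: "x \<in> insert r (set (v # ys))" "a \<in> {1, -1}" "b \<in> {1, -1}" "c = col v a x b"
    using edge_column_at[OF assms(1,3)] by blast
  moreover have "x \<noteq> v"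
    using * assms(2) unfolding loop_column_def by auto
  ultimately show ?thesis
    by auto
qed

text \<open>A vanishing entry at \<open>v\<close> means that no end is \<open>v\<close> only because
  loops are excluded: a positive loop at \<open>v\<close> has entry 0 there as well.\<close>

lemma edge_column_below:
  assumes "edge_column (insert r (set (v # ys))) c" "\<not> loop_column (insert r (set (v # ys))) c"
    and "c v = 0"
  shows "edge_column (insert r (set ys)) c"
proof -
  obtain x y a b where *: "x \<in> insert r (set (v # ys))" "y \<in> insert r (set (v # ys))"
    "a \<in> {1, -1}" "b \<in> {1, -1}" "c = col x a y b"
    using assms(1) unfolding edge_column_def by blast
  then have "x \<noteq> y"
    using assms(2) unfolding loop_column_def by blast
  then have "x \<noteq> v" "y \<noteq> v"
    using *(3-5) assms(3) by (auto simp: col_def)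
  then show ?thesis
    using * by (auto intro!: edge_column_col)
qed

text \<open>An edge at \<open>v\<close> has just one further end, so it cannot join two distinct
  vertices of the tail. The tail is attached by edges avoiding \<open>v\<close>, and those are kept
  unchanged.\<close>

lemma attached_tail:
  assumes att: "attached (joined E M) r (v # ys)"
    and columns: "\<And>e. e \<in> E \<Longrightarrow> edge_column V (M e)"
    and keep: "\<And>e. e \<in> E \<Longrightarrow> M e v = 0 \<Longrightarrow> e \<in> E' \<and> M' e = M e"
  shows "attached (joined E' M') r ys"
proof (rule attached_mono)
  show "attached (joined E M) r ys"
    using att by simp
next
  fix w y
  assume wy: "w \<in> set ys" "y \<in> insert r (set ys)" "w \<noteq> y" and "joined E M w y"
  then obtain e where e: "e \<in> E" "M e w \<noteq> 0" "M e y \<noteq> 0"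
    unfolding joined_def by blast
  have "w \<noteq> v" "y \<noteq> v"
    using att wy by auto
  have "M e v = 0"
  proof (rule ccontr)
    assume "M e v \<noteq> 0"
    then obtain x a b where "M e = col v a x b"
      using edge_column_at[OF columns[OF e(1)]] by blast
    then have "M e u = 0" if "u \<noteq> v" "u \<noteq> x" for u
      using that by (simp add: col_def)
    then show False
      using e \<open>w \<noteq> v\<close> \<open>y \<noteq> v\<close> \<open>w \<noteq> y\<close> by metis
  qed
  then show "joined E' M' w y"
    using keep[OF e(1)] e unfolding joined_def by (intro bexI[of _ e]) auto
qed

lemma attached_head:
  assumes "e \<in> E" "M e = col v a x b" "a \<in> {1, -1}" "b \<in> {1, -1}" "x \<noteq> v"
    "x \<in> insert r (set ys)" "v \<notin> insert r (set ys)" "attached (joined E M) r ys"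
  shows "attached (joined E M) r (v # ys)"
proof -
  have "joined E M v x"
    using assms(1-5) unfolding joined_def by (intro bexI[of _ e]) (auto simp: col_def)
  then show ?thesis
    using assms by auto
qed

section \<open>Deleting and merging edges at the last vertex\<close>

text \<open>The degrees of \<open>H\<close> do not see \<open>e\<close>, and the second edge
  \<open>e'\<close> still attaches \<open>v\<close>.\<close>

lemma even_system_drop_edge:
  assumes sys: "even_system r (v # ys) E M H" and e: "e \<in> E - H" "M e v \<noteq> 0"
    and e': "e' \<in> E" "e' \<noteq> e" "M e' v \<noteq> 0"
    and noloop: "\<And>e. e \<in> E \<Longrightarrow> \<not> loop_column (insert r (set (v # ys))) (M e)"
  shows "even_system r (v # ys) (E - {e}) M H"
proof -
  have col: "\<And>e. e \<in> E \<Longrightarrow> edge_column (insert r (set (v # ys))) (M e)"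
    and att: "attached (joined E M) r (v # ys)"
    using sys unfolding even_system_def by blast+
  have tail: "attached (joined (E - {e}) M) r ys"
    by (rule attached_tail[OF att col]) (use e in auto)
  obtain x a b where x: "x \<in> insert r (set ys)" "a \<in> {1, -1}" "b \<in> {1, -1}" "x \<noteq> v"
    "M e' = col v a x b"
    using edge_column_top[OF col[OF e'(1)] noloop[OF e'(1)] e'(3)] by blast
  have "attached (joined (E - {e}) M) r (v # ys)"
    by (rule attached_head[OF _ x(5) x(2,3,4,1) _ tail]) (use e' att in auto)
  then show ?thesis
    using sys e unfolding even_system_def by blast
qed

lemma solution_insert_edge:
  assumes "finite E" "e \<in> E - H" "solution r xs (E - {e}) M H D f"
  shows "solution r xs E M H D (f(e := 0))"
proof -
  have "net_flow E M (f(e := 0)) u = net_flow (E - {e}) M f u" for u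
    using assms(2) net_flow_remove[OF assms(1), of e M "f(e := 0)" u] by simp
  then show ?thesis
    using assms(2,3) unfolding solution_def by auto
qed

text \<open>If \<open>e'\<close> carries \<open>s\<close> times the value of \<open>e\<close>, the
  two edges act as one combined column scaled by \<open>f e\<close>. Its part at the far ends is the
  merged edge, stored under the name \<open>e\<close>; what is left at \<open>v\<close> is the
  correction term.\<close>

lemma net_flow_merge:
  assumes fin: "finite E" and e: "e \<in> E" "e' \<in> E" "e \<noteq> e'"
    and M: "M e = col v c x a" "M e' = col v d y b"
  shows "net_flow E M (f(e' := s * f e)) u =
    net_flow (E - {e'}) (M(e := col x a y (s * b))) f u + (if u = v then f e * (c + s * d) else 0)"
proof -
  have "net_flow (E - {e'} - {e}) M (f(e' := s * f e)) u =
    net_flow (E - {e'} - {e}) (M(e := col x a y (s * b))) f u"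
    by (rule net_flow_cong) auto
  moreover have "net_flow E M (f(e' := s * f e)) u =
      s * f e * M e' u + (f e * M e u + net_flow (E - {e'} - {e}) M (f(e' := s * f e)) u)"
    using net_flow_remove[OF fin e(2), of M "f(e' := s * f e)" u]
      net_flow_remove[of "E - {e'}" e M "f(e' := s * f e)" u] fin e by simp
  moreover have "net_flow (E - {e'}) (M(e := col x a y (s * b))) f u =
      f e * col x a y (s * b) u + net_flow (E - {e'} - {e}) (M(e := col x a y (s * b))) f u"
    using net_flow_remove[of "E - {e'}" e "M(e := col x a y (s * b))" f u] fin e by simp
  ultimately show ?thesis
    by (simp add: M col_def algebra_simps)
qed

text \<open>An odd factor \<open>s\<close> on one column does not alter parities, and the amount
  \<open>c + s * d\<close> lost at \<open>v\<close> is even.\<close>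

lemma even_net_flow_merge:
  assumes fin: "finite H" and e: "e \<in> H" "e' \<in> H" "e \<noteq> e'"
    and M: "M e = col v c x a" "M e' = col v d y b"
    and s: "odd s" "odd c" "odd d"
  shows "even (net_flow (H - {e'}) (M(e := col x a y (s * b))) (\<lambda>_. 1) u) \<longleftrightarrow>
    even (net_flow H M (\<lambda>_. 1) u)"
proof -
  \<comment> \<open>The merging identity is applied to the constant 1, whose value at
    \<open>e'\<close> it replaces by \<open>s\<close>; this replacement is undone below.\<close>
  have "net_flow H M ((\<lambda>_. 1)(e' := s * 1)) u =
    net_flow (H - {e'}) (M(e := col x a y (s * b))) (\<lambda>_. 1) u + (if u = v then 1 * (c + s * d) else 0)"
    by (rule net_flow_merge[OF assms(1-6)])
  moreover have "net_flow H M ((\<lambda>_. 1)(e' := s * 1)) u = s * M e' u + net_flow (H - {e'}) M (\<lambda>_. 1) u"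
    using net_flow_remove[OF fin e(2), of M "(\<lambda>_. 1)(e' := s * 1)" u] by simp
  moreover have "net_flow H M (\<lambda>_. 1) u = M e' u + net_flow (H - {e'}) M (\<lambda>_. 1) u"
    using net_flow_remove[OF fin e(2), of M "\<lambda>_. 1" u] by simp
  ultimately have "net_flow (H - {e'}) (M(e := col x a y (s * b))) (\<lambda>_. 1) u =
    net_flow H M (\<lambda>_. 1) u + (s - 1) * M e' u - (if u = v then c + s * d else 0)"
    by (cases "u = v") (simp_all add: algebra_simps)
  then show ?thesis
    using s by simp
qed

text \<open>A third edge \<open>e3\<close> at \<open>v\<close> survives the merging and keeps
  \<open>v\<close> attached.\<close>

lemma even_system_merge_keep:
  assumes sys: "even_system r (v # ys) E M H" and e: "e \<in> H" "e' \<in> H" "e \<noteq> e'"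
    and e3: "e3 \<in> E" "e3 \<noteq> e" "e3 \<noteq> e'" "M e3 v \<noteq> 0"
    and M: "M e = col v c x a" "M e' = col v d y b"
    and signs: "a \<in> {1, -1}" "b \<in> {1, -1}" "c \<in> {1, -1}" "d \<in> {1, -1}" "s \<in> {1, -1}"
    and xy: "x \<in> insert r (set ys)" "y \<in> insert r (set ys)" "x \<noteq> v" "y \<noteq> v"
    and noloop: "\<And>e. e \<in> E \<Longrightarrow> \<not> loop_column (insert r (set (v # ys))) (M e)"
  shows "even_system r (v # ys) (E - {e'}) (M(e := col x a y (s * b))) (H - {e'})"
proof -
  let ?M = "M(e := col x a y (s * b))"
  have fin: "finite E" and HE: "H \<subseteq> E"
    and col: "\<And>e. e \<in> E \<Longrightarrow> edge_column (insert r (set (v # ys))) (M e)"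
    and ev: "\<And>u. u \<in> insert r (set (v # ys)) \<Longrightarrow> even (net_flow H M (\<lambda>_. 1) u)"
    and att: "attached (joined E M) r (v # ys)"
    using sys unfolding even_system_def by blast+
  have finH: "finite H"
    using fin HE finite_subset by blast
  have nz: "M e v \<noteq> 0" "M e' v \<noteq> 0"
    using M signs xy by (auto simp: col_def)
  have tail: "attached (joined (E - {e'}) ?M) r ys"
    by (rule attached_tail[OF att col]) (use nz in auto)
  obtain z k l where z: "z \<in> insert r (set ys)" "k \<in> {1, -1}" "l \<in> {1, -1}" "z \<noteq> v"
    "M e3 = col v k z l"
    using edge_column_top[OF col[OF e3(1)] noloop[OF e3(1)] e3(4)] by blast
  have "attached (joined (E - {e'}) ?M) r (v # ys)"
    by (rule attached_head[of e3 _ _ _ k z l, OF _ _ z(2,3,4,1) _ tail]) (use e3 z att in auto)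
  moreover have "edge_column (insert r (set (v # ys))) (?M e'')" if "e'' \<in> E - {e'}" for e''
    using col that xy signs by (auto intro!: edge_column_col)
  moreover have "even (net_flow (H - {e'}) ?M (\<lambda>_. 1) u)" if "u \<in> insert r (set (v # ys))" for u
    using even_net_flow_merge[OF finH e M, of s] ev[OF that] signs by auto
  ultimately show ?thesis
    using fin HE unfolding even_system_def by blast
qed

text \<open>With no third edge at \<open>v\<close>, merging isolates \<open>v\<close>, which can
  leave the vertex list. If \<open>x = y\<close>, the merged edge is a loop, which
  \<open>edge_column\<close> admits.\<close>

lemma even_system_merge_drop:
  assumes sys: "even_system r (v # ys) E M H" and e: "e \<in> H" "e' \<in> H" "e \<noteq> e'"
    and only: "\<And>e''. e'' \<in> E \<Longrightarrow> M e'' v \<noteq> 0 \<Longrightarrow> e'' = e \<or> e'' = e'"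
    and M: "M e = col v c x a" "M e' = col v d y b"
    and signs: "a \<in> {1, -1}" "b \<in> {1, -1}" "c \<in> {1, -1}" "d \<in> {1, -1}" "s \<in> {1, -1}"
    and xy: "x \<in> insert r (set ys)" "y \<in> insert r (set ys)" "x \<noteq> v" "y \<noteq> v"
    and noloop: "\<And>e. e \<in> E \<Longrightarrow> \<not> loop_column (insert r (set (v # ys))) (M e)"
  shows "even_system r ys (E - {e'}) (M(e := col x a y (s * b))) (H - {e'})"
proof -
  let ?M = "M(e := col x a y (s * b))"
  have fin: "finite E" and HE: "H \<subseteq> E"
    and col: "\<And>e. e \<in> E \<Longrightarrow> edge_column (insert r (set (v # ys))) (M e)"
    and ev: "\<And>u. u \<in> insert r (set (v # ys)) \<Longrightarrow> even (net_flow H M (\<lambda>_. 1) u)"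
    and att: "attached (joined E M) r (v # ys)"
    using sys unfolding even_system_def by blast+
  have finH: "finite H"
    using fin HE finite_subset by blast
  have nz: "M e v \<noteq> 0" "M e' v \<noteq> 0"
    using M signs xy by (auto simp: col_def)
  have "attached (joined (E - {e'}) ?M) r ys"
    by (rule attached_tail[OF att col]) (use nz in auto)
  moreover have "edge_column (insert r (set ys)) (?M e'')" if e'': "e'' \<in> E - {e'}" for e''
  proof (cases "e'' = e")
    case True
    have "edge_column (insert r (set ys)) (col x a y (s * b))"
      by (rule edge_column_col) (use xy signs in auto)
    then show ?thesis using True by simp
  next
    case False
    then have "M e'' v = 0"
      using only e'' by blast
    then show ?thesis
      using edge_column_below[OF col noloop, of e''] e'' False by simp
  qed
  moreover have "even (net_flow (H - {e'}) ?M (\<lambda>_. 1) u)" if "u \<in> insert r (set ys)" for u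
    using even_net_flow_merge[OF finH e M, of s] ev[of u] that signs by auto
  ultimately show ?thesis
    using fin HE unfolding even_system_def by blast
qed

text \<open>The choice of \<open>s\<close> cancels the two edges at \<open>v\<close>, since
  \<open>d * d = 1\<close>, so all boundaries agree with those of the merged system.\<close>

lemma solution_merge_keep:
  assumes fin: "finite E" and HE: "H \<subseteq> E" and e: "e \<in> H" "e' \<in> H" "e \<noteq> e'"
    and M: "M e = col v c x a" "M e' = col v d y b"
    and signs: "c \<in> {1, -1}" "d \<in> {1, -1}" and s: "s = - (c * d)"
    and sol: "solution r xs (E - {e'}) (M(e := col x a y (s * b))) (H - {e'}) D f"
  shows "solution r xs E M H D (f(e' := s * f e))"
proof -
  have "c + s * d = 0"
    using signs s by auto
  then have "net_flow E M (f(e' := s * f e)) u = net_flow (E - {e'}) (M(e := col x a y (s * b))) f u" for u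
    using net_flow_merge[OF fin _ _ e(3) M, of f s u] HE e by (simp add: subset_iff)
  moreover have "\<bar>f e\<bar> \<le> 2" "odd (f e)"
    using sol e HE unfolding solution_def by auto
  moreover have "s \<in> {1, -1}"
    using signs s by auto
  ultimately show ?thesis
    using sol e unfolding solution_def by auto
qed

text \<open>The boundary at \<open>v\<close> comes from the two edges alone: it is
  \<open>f e * (c + s * d)\<close>, which is 0 for one sign of \<open>s\<close> and 2 or -2 for the
  other, as \<open>f e\<close> is 1 or -1. So \<open>s\<close> realizes either even residue of
  \<open>D v\<close> modulo 4.\<close>

lemma solution_merge_drop:
  assumes fin: "finite E" and HE: "H \<subseteq> E" and e: "e \<in> H" "e' \<in> H" "e \<noteq> e'"
    and only: "\<And>e''. e'' \<in> E \<Longrightarrow> M e'' v \<noteq> 0 \<Longrightarrow> e'' = e \<or> e'' = e'"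
    and M: "M e = col v c x a" "M e' = col v d y b" and xy: "x \<noteq> v" "y \<noteq> v"
    and v: "v \<notin> insert r (set ys)"
    and signs: "c \<in> {1, -1}" "d \<in> {1, -1}" "even (D v)"
    and s: "s = (if 4 dvd D v then - (c * d) else c * d)"
    and sol: "solution r ys (E - {e'}) (M(e := col x a y (s * b))) (H - {e'}) D f"
  shows "solution r (v # ys) E M H D (f(e' := s * f e))"
proof -
  let ?M = "M(e := col x a y (s * b))"
  have merge: "net_flow E M (f(e' := s * f e)) u =
      net_flow (E - {e'}) ?M f u + (if u = v then f e * (c + s * d) else 0)" for u
    using net_flow_merge[OF fin _ _ e(3) M, of f s u] HE e by blast
  have fe: "\<bar>f e\<bar> \<le> 2" "odd (f e)"
    using sol e HE unfolding solution_def by auto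
  then have fe1: "f e = 1 \<or> f e = -1"
    by (cases "f e = 0"; cases "f e = 2"; cases "f e = -2") auto
  \<comment> \<open>After merging, no column has an entry at \<open>v\<close>: the new edge runs
    between \<open>x\<close> and \<open>y\<close>, both different from \<open>v\<close>.\<close>
  have "net_flow (E - {e'}) ?M f v = 0"
    unfolding net_flow_def
  proof (rule sum.neutral, rule)
    fix e'' assume "e'' \<in> E - {e'}"
    then have "?M e'' v = 0"
      using only xy by (cases "e'' = e") (auto simp: col_def)
    then show "f e'' * ?M e'' v = 0" by simp
  qed
  then have nv: "net_flow E M (f(e' := s * f e)) v = f e * (c + s * d)"
    using merge[of v] by simp
  have 1: "f e * (c + s * d) \<in> {-2, 0, 2}"
    using fe1 signs by (auto simp: s)
  have 2: "4 dvd f e * (c + s * d) - D v"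
  proof (cases "4 dvd D v")
    case True
    then have "c + s * d = 0" using signs by (auto simp: s)
    then show ?thesis using True by simp
  next
    case False
    then have "f e * (c + s * d) \<in> {2, -2}" using fe1 signs by (auto simp: s)
    then show ?thesis using False signs(3) by (auto; presburger)
  qed
  have "s \<in> {1, -1}"
    using signs s by auto
  moreover have "net_flow E M (f(e' := s * f e)) u = net_flow (E - {e'}) ?M f u" if "u \<noteq> v" for u
    using merge that by simp
  moreover have "u \<noteq> v" if "u \<in> insert r (set ys)" for u
    using v that by blast
  ultimately show ?thesis
    using sol e fe 1 2 unfolding solution_def by (auto simp: nv)
qed

section \<open>A single edge outside \<open>H\<close> at the last vertex\<close>

lemma even_system_remove_leaf:
  assumes sys: "even_system r (v # ys) E M H" and e: "e \<in> E - H" "M e v \<noteq> 0"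
    and only: "\<And>e'. e' \<in> E \<Longrightarrow> M e' v \<noteq> 0 \<Longrightarrow> e' = e"
    and noloop: "\<And>e. e \<in> E \<Longrightarrow> \<not> loop_column (insert r (set (v # ys))) (M e)"
  shows "even_system r ys (E - {e}) M H"
proof -
  have col: "\<And>e. e \<in> E \<Longrightarrow> edge_column (insert r (set (v # ys))) (M e)"
    and att: "attached (joined E M) r (v # ys)"
    using sys unfolding even_system_def by blast+
  have "attached (joined (E - {e}) M) r ys"
    by (rule attached_tail[OF att col]) (use e in auto)
  moreover have "edge_column (insert r (set ys)) (M e')" if "e' \<in> E - {e}" for e'
    using edge_column_below[OF col noloop, of e'] only[of e'] that by blast
  ultimately show ?thesis
    using sys e unfolding even_system_def by auto
qed

text \<open>The edge must carry 0 or a 2 of either sign to serve \<open>D v\<close>. This adds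
  \<open>D v\<close> modulo 4 at \<open>x\<close>, where the target was already raised by
  \<open>D v\<close>; the total \<open>2 * D v\<close> vanishes modulo 4.\<close>

lemma solution_add_leaf:
  assumes fin: "finite E" and e: "e \<in> E - H"
    and only: "\<And>e'. e' \<in> E \<Longrightarrow> M e' v \<noteq> 0 \<Longrightarrow> e' = e"
    and M: "M e = col v a x b" "a \<in> {1, -1}" "b \<in> {1, -1}"
    and x: "x \<in> insert r (set ys)" "x \<noteq> v"
    and v: "v \<notin> insert r (set ys)" and D: "even (D v)"
    and sol: "solution r ys (E - {e}) M H (D(x := D x + D v)) f"
  shows "\<exists>g. solution r (v # ys) E M H D g"
proof -
  define S where "S = net_flow (E - {e}) M f x"
  have S: "S \<in> {-2, 0, 2}"
    using sol x unfolding S_def solution_def by blast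
  obtain t :: int where t: "t \<in> {-2, 0, 2}" "t = 0 \<longleftrightarrow> 4 dvd D v" "S + t * b \<in> {-2, 0, 2}"
  proof (cases "4 dvd D v")
    case True
    then show ?thesis using that[of 0] S by auto
  next
    case False
    \<comment> \<open>The sign of \<open>t\<close> is irrelevant modulo 4, so it is chosen to keep
      the boundary at \<open>x\<close> in range.\<close>
    have "S + 2 * b \<in> {-2, 0, 2} \<or> S - 2 * b \<in> {-2, 0, 2}"
      using S M by auto
    then show ?thesis
      using False that[of 2] that[of "-2"] by auto
  qed
  have modx: "4 dvd S + t * b - D x" if "x \<in> set ys"
  proof -
    have "4 dvd S - (D x + D v)"
      using sol that unfolding solution_def S_def by auto
    then show ?thesis
      using D t(1,2) M by (auto; presburger)
  qed
  have modv: "4 dvd t * a - D v"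
    using D t(1,2) M by (auto; presburger)
  have "net_flow (E - {e}) M f v = 0"
    unfolding net_flow_def by (rule sum.neutral) (use only in fastforce)
  then have nf: "net_flow E M (f(e := t)) u =
      (if u = v then t * a else if u = x then S + t * b else net_flow (E - {e}) M f u)" for u
    using net_flow_remove[OF fin, of e M "f(e := t)" u] e x(2) by (auto simp: M(1) col_def S_def)
  have "t * a \<in> {-2, 0, 2}"
    using t M by auto
  moreover have "\<bar>t\<bar> \<le> 2" "even t"
    using t by auto
  ultimately have "solution r (v # ys) E M H D (f(e := t))"
    using sol e t(3) modx modv v unfolding solution_def nf by auto
  then show ?thesis by blast
qed

section \<open>Solving even systems by induction\<close>

lemma even_system_solvable:
  assumes "even_system r xs E M H" "\<And>v. even (D v)"
  shows "\<exists>f. solution r xs E M H D f"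
  using assms
\<comment> \<open>Every reduction deletes an edge. \<open>D\<close> must vary because loops and
  leaves shift it, and \<open>M\<close> because merging rewrites a column.\<close>
proof (induction "length xs + card E" arbitrary: xs E M H D rule: less_induct)
  case less
  note sys = less.prems(1) and D = less.prems(2)
  let ?V = "insert r (set xs)"
  have fin: "finite E" and HE: "H \<subseteq> E" and col: "\<And>e. e \<in> E \<Longrightarrow> edge_column ?V (M e)"
    and ev: "\<And>u. u \<in> ?V \<Longrightarrow> even (net_flow H M (\<lambda>_. 1) u)"
    and att: "attached (joined E M) r xs"
    using sys unfolding even_system_def by blast+
  have card: "card (E - {e}) < card E" if "e \<in> E" for e
    using fin that by (rule card_Diff1_less)
  show ?case
  proof (cases "\<exists>e\<in>E. loop_column ?V (M e)")
    case True
    then obtain e x a b where e: "e \<in> E" and x: "x \<in> ?V"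
      and ab: "a \<in> {1, -1}" "b \<in> {1, -1}" and M: "M e = col x a x b"
      unfolding loop_column_def by blast
    let ?D = "D(x := D x + (if e \<in> H then a + b else 0))"
    have "\<exists>f. solution r xs (E - {e}) M (H - {e}) ?D f"
    proof (rule less.hyps)
      show "even_system r xs (E - {e}) M (H - {e})"
        by (rule even_system_remove_loop[OF sys e M ab])
      show "even (?D v)" for v
        using D ab by auto
    qed (use card[OF e] in simp)
    then show ?thesis
      using solution_add_loop[OF sys e M ab x] by blast
  next
    case noloop: False
    show ?thesis
    proof (cases xs)
      case Nil
      \<comment> \<open>With \<open>r\<close> as the only vertex every edge would be a loop.\<close>
      have "E = {}"
        using noloop col unfolding Nil edge_column_def loop_column_def by fastforce
      then have "solution r xs E M H D (\<lambda>_. 0)"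
        by (simp add: solution_def net_flow_def Nil)
      then show ?thesis by blast
    next
      case (Cons v ys)
      note sys' = sys[unfolded Cons]
      have noloop': "\<And>e. e \<in> E \<Longrightarrow> \<not> loop_column (insert r (set (v # ys))) (M e)"
        using noloop unfolding Cons by blast
      have v: "v \<notin> insert r (set ys)"
        using att unfolding Cons by simp
      define K where "K = {e \<in> E. M e v \<noteq> 0}"
      have top: "\<exists>x\<in>insert r (set ys). \<exists>a\<in>{1, -1}. \<exists>b\<in>{1, -1}. x \<noteq> v \<and> M e = col v a x b"
        if "e \<in> K" for e
        using edge_column_top[OF col[unfolded Cons] noloop'] that unfolding K_def by blast
      obtain e where e: "e \<in> K"
        using att unfolding Cons K_def by (auto simp: joined_def)
      show ?thesis
      proof (cases "K \<subseteq> H")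
        case False
        then obtain e where e: "e \<in> K" "e \<in> E - H"
          unfolding K_def by blast
        show ?thesis
        proof (cases "\<exists>e'\<in>K. e' \<noteq> e")
          case True
          then obtain e' where "e' \<in> E" "e' \<noteq> e" "M e' v \<noteq> 0"
            unfolding K_def by blast
          then have "even_system r (v # ys) (E - {e}) M H"
            using even_system_drop_edge[OF sys' e(2) _ _ _ _ noloop'] e(1) unfolding K_def by blast
          then have "\<exists>f. solution r (v # ys) (E - {e}) M H D f"
            using D card[of e] e by (intro less.hyps) (auto simp: Cons)
          then show ?thesis
            using solution_insert_edge[OF fin e(2)] unfolding Cons by metis
        next
          case False
          then have only: "\<And>e'. e' \<in> E \<Longrightarrow> M e' v \<noteq> 0 \<Longrightarrow> e' = e"
            unfolding K_def by blast
          obtain x a b where x: "x \<in> insert r (set ys)" "x \<noteq> v"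
            and M: "M e = col v a x b" "a \<in> {1, -1}" "b \<in> {1, -1}"
            using top[OF e(1)] by blast
          have "even_system r ys (E - {e}) M H"
            by (rule even_system_remove_leaf[OF sys' e(2) _ only noloop']) (use e in \<open>auto simp: K_def\<close>)
          then have "\<exists>f. solution r ys (E - {e}) M H (D(x := D x + D v)) f"
            using D card[of e] e by (intro less.hyps) (auto simp: Cons)
          then show ?thesis
            using solution_add_leaf[where D = D and M = M and v = v, OF fin e(2) only M x v D] unfolding Cons by blast
        qed
      next
        case True
        \<comment> \<open>A lone edge at \<open>v\<close>, lying in \<open>H\<close>, would give
          \<open>H\<close> odd degree there.\<close>
        have "\<exists>e'\<in>K. e' \<noteq> e"
        proof (rule ccontr)
          assume "\<not> ?thesis"
          then have K: "K = {e}"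
            using e by blast
          have "net_flow H M (\<lambda>_. 1) v = net_flow K M (\<lambda>_. 1) v"
            unfolding net_flow_def
            by (rule sum.mono_neutral_right) (use True fin HE finite_subset in \<open>auto simp: K_def\<close>)
          also have "\<dots> = M e v"
            by (simp add: K net_flow_def)
          finally have "even (M e v)"
            using ev[of v] by (simp add: Cons)
          moreover obtain x a b where "a \<in> {1, -1}" "x \<noteq> v" "M e = col v a x b"
            using top[OF e] by blast
          ultimately show False
            by (auto simp: col_def)
        qed
        then obtain e' where e': "e' \<in> K" "e \<noteq> e'"
          by blast
        have eH: "e \<in> H" "e' \<in> H"
          using e e' True by auto
        obtain x c a where x: "x \<in> insert r (set ys)" "x \<noteq> v"
          and M: "M e = col v c x a" "c \<in> {1, -1}" "a \<in> {1, -1}"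
          using top[OF e] by blast
        obtain y d b where y: "y \<in> insert r (set ys)" "y \<noteq> v"
          and M': "M e' = col v d y b" "d \<in> {1, -1}" "b \<in> {1, -1}"
          using top[OF e'(1)] by blast
        have card': "card (E - {e'}) < card E"
          using card e' K_def by blast
        show ?thesis
        proof (cases "\<exists>e3\<in>K. e3 \<noteq> e \<and> e3 \<noteq> e'")
          case True
          then obtain e3 where e3: "e3 \<in> E" "e3 \<noteq> e" "e3 \<noteq> e'" "M e3 v \<noteq> 0"
            unfolding K_def by blast
          define s where "s = - (c * d)"
          have s: "s \<in> {1, -1}"
            using M M' unfolding s_def by auto
          have "even_system r (v # ys) (E - {e'}) (M(e := col x a y (s * b))) (H - {e'})"
            by (rule even_system_merge_keep[where M = M and v = v, OF sys' eH e'(2) e3 M(1) M'(1) M(3) M'(3) M(2) M'(2) s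
                  x(1) y(1) x(2) y(2) noloop'])
          then have "\<exists>f. solution r (v # ys) (E - {e'}) (M(e := col x a y (s * b))) (H - {e'}) D f"
            using D card' by (intro less.hyps) (auto simp: Cons)
          then show ?thesis
            using solution_merge_keep[where M = M and v = v, OF fin HE eH e'(2) M(1) M'(1) M(2) M'(2) s_def]
            unfolding Cons by metis
        next
          case False
          then have only: "\<And>e''. e'' \<in> E \<Longrightarrow> M e'' v \<noteq> 0 \<Longrightarrow> e'' = e \<or> e'' = e'"
            unfolding K_def by blast
          define s where "s = (if 4 dvd D v then - (c * d) else c * d)"
          have s: "s \<in> {1, -1}"
            using M M' unfolding s_def by auto
          have "even_system r ys (E - {e'}) (M(e := col x a y (s * b))) (H - {e'})"
            by (rule even_system_merge_drop[where M = M and v = v, OF sys' eH e'(2) only M(1) M'(1) M(3) M'(3) M(2) M'(2) s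
                  x(1) y(1) x(2) y(2) noloop'])
          then have "\<exists>f. solution r ys (E - {e'}) (M(e := col x a y (s * b))) (H - {e'}) D f"
            using D card' by (intro less.hyps) (auto simp: Cons)
          then show ?thesis
            using solution_merge_drop[where D = D and M = M and v = v, OF fin HE eH e'(2) only M(1) M'(1) x(2) y(2) v M(2) M'(2)
                D s_def]
            unfolding Cons by metis
        qed
      qed
    qed
  qed
qed

section \<open>From half-edges to incidence columns\<close>

context finite_multigraph
begin

lemma edge_halfedges:
  assumes "e \<in> edges G"
  obtains h h' where "h \<in> halfedges G" "h' \<in> halfedges G" "h \<noteq> h'"
    "edge_of G h = e" "edge_of G h' = e" "{k \<in> halfedges G. edge_of G k = e} = {h, h'}"
proof -
  obtain h h' where "{k \<in> halfedges G. edge_of G k = e} = {h, h'}" "h \<noteq> h'"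
    using two_halfedges[OF assms] unfolding card_2_iff by blast
  moreover from this have "h \<in> {k \<in> halfedges G. edge_of G k = e}" "h' \<in> {k \<in> halfedges G. edge_of G k = e}"
    by auto
  ultimately show ?thesis
    using that by blast
qed

lemma finite_halfedges: "finite (halfedges G)"
proof (rule finite_subset)
  show "halfedges G \<subseteq> (\<Union>e\<in>edges G. {h \<in> halfedges G. edge_of G h = e})"
    using edge_of_in by blast
  show "finite (\<Union>e\<in>edges G. {h \<in> halfedges G. edge_of G h = e})"
  proof (rule finite_UN_I[OF finite_edges])
    fix e assume "e \<in> edges G"
    then show "finite {h \<in> halfedges G. edge_of G h = e}"
      using two_halfedges by (intro card_ge_0_finite) simp
  qed
qed

definition incidence :: "('h \<Rightarrow> int) \<Rightarrow> 'e \<Rightarrow> 'v \<Rightarrow> int" where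
  "incidence \<tau> e v = (\<Sum>h | h \<in> halfedges G \<and> edge_of G h = e. if end_of G h = v then \<tau> h else 0)"

lemma incidence_eq_col:
  assumes "{k \<in> halfedges G. edge_of G k = e} = {h, h'}" "h \<noteq> h'"
  shows "incidence \<tau> e = col (end_of G h) (\<tau> h) (end_of G h') (\<tau> h')"
  unfolding incidence_def assms(1) col_def using assms(2) by (auto intro!: ext)

text \<open>The half-edges at \<open>v\<close> are grouped by the edges containing them; a loop
  contributes both of its half-edges.\<close>

lemma boundary_eq_net_flow: "boundary G \<tau> f v = net_flow (edges G) (incidence \<tau>) f v"
proof -
  let ?g = "\<lambda>h. f (edge_of G h) * (if end_of G h = v then \<tau> h else 0)"
  have "boundary G \<tau> f v = sum ?g (halfedges G)"
    unfolding boundary_def halfedges_at_def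
    by (rule sum.mono_neutral_cong_left) (use finite_halfedges in auto)
  also have "\<dots> = (\<Sum>e\<in>edges G. sum ?g {h \<in> halfedges G. edge_of G h = e})"
    by (rule sum.group[symmetric]) (use finite_halfedges finite_edges edge_of_in in auto)
  also have "\<dots> = net_flow (edges G) (incidence \<tau>) f v"
    unfolding net_flow_def incidence_def sum_distrib_left by (intro sum.cong refl) auto
  finally show ?thesis .
qed

lemma edge_column_incidence:
  assumes "orientation G \<sigma> \<tau>" "e \<in> edges G"
  shows "edge_column (vertices G) (incidence \<tau> e)"
proof -
  obtain h h' where h: "h \<in> halfedges G" "h' \<in> halfedges G" "h \<noteq> h'"
    "{k \<in> halfedges G. edge_of G k = e} = {h, h'}"
    using edge_halfedges[OF assms(2)] by metis
  show ?thesis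
    unfolding incidence_eq_col[OF h(4,3)]
    by (rule edge_column_col) (use h end_of_in assms(1) in \<open>auto simp: orientation_def\<close>)
qed

text \<open>Distinct ends prevent the two orientation values from meeting in one entry, where they
  could cancel.\<close>

lemma joined_of_adjacency:
  assumes "orientation G \<sigma> \<tau>" "(u, v) \<in> adjacency G" "u \<noteq> v"
  shows "joined (edges G) (incidence \<tau>) v u"
proof -
  obtain h h' where h: "h \<in> halfedges G" "h' \<in> halfedges G" "h \<noteq> h'" "edge_of G h = edge_of G h'"
    and uv: "u = end_of G h" "v = end_of G h'"
    using assms(2) unfolding adjacency_def by blast
  obtain k k' where k: "k \<noteq> k'" "{l \<in> halfedges G. edge_of G l = edge_of G h} = {k, k'}"
    using edge_halfedges[OF edge_of_in[OF h(1)]] by metis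
  moreover have "{h, h'} \<subseteq> {l \<in> halfedges G. edge_of G l = edge_of G h}"
    using h by auto
  \<comment> \<open>An edge has exactly two half-edges, so the adjacent pair is all of them.\<close>
  ultimately have "{h, h'} = {k, k'}"
    using h(3) by (intro card_subset_eq) auto
  with k have "incidence \<tau> (edge_of G h) = col (end_of G h) (\<tau> h) (end_of G h') (\<tau> h')"
    using h(3) by (intro incidence_eq_col) simp_all
  moreover have "\<tau> h \<noteq> 0" "\<tau> h' \<noteq> 0"
    using assms(1) h(1,2) unfolding orientation_def by auto
  ultimately show ?thesis
    using edge_of_in[OF h(1)] assms(3) uv unfolding joined_def
    by (intro bexI[of _ "edge_of G h"]) (auto simp: col_def)
qed

lemma exists_attached_vertices:
  assumes "orientation G \<sigma> \<tau>" "connected_multigraph G" "r \<in> vertices G"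
  shows "\<exists>xs. attached (joined (edges G) (incidence \<tau>)) r xs \<and> insert r (set xs) = vertices G"
proof (rule exists_spanning_attached[OF finite_vertices assms(3)])
  fix S assume S: "S \<subset> vertices G" "r \<in> S"
  then obtain w where w: "w \<in> vertices G" "w \<notin> S"
    by blast
  have "(r, w) \<in> (adjacency G)\<^sup>*"
    using assms(2,3) w unfolding connected_multigraph_def by blast
  \<comment> \<open>A walk from \<open>r\<close> to a vertex outside \<open>S\<close> must leave
    \<open>S\<close> at some step.\<close>
  then have "w \<notin> S \<longrightarrow> (\<exists>u v. (u, v) \<in> adjacency G \<and> u \<in> S \<and> v \<notin> S)"
    by (induction rule: rtrancl_induct) (use S in blast)+
  then obtain u v where uv: "(u, v) \<in> adjacency G" "u \<in> S" "v \<notin> S"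
    using w by blast
  then have "v \<in> vertices G"
    using end_of_in unfolding adjacency_def by blast
  moreover have "joined (edges G) (incidence \<tau>) v u"
    using uv by (intro joined_of_adjacency[OF assms(1)]) auto
  ultimately show "\<exists>v\<in>vertices G - S. \<exists>y\<in>S. joined (edges G) (incidence \<tau>) v y"
    using uv by blast
qed

text \<open>Summed over all vertices, a column gives 0 for a positive edge and 2 or -2 for a
  negative one. Modulo 4 the latter, times \<open>f e\<close>, is 2 if \<open>f e\<close> is odd and
  0 otherwise.\<close>

lemma sum_boundary_cong:
  assumes or: "orientation G \<sigma> \<tau>"
  shows "[(\<Sum>v\<in>vertices G. boundary G \<tau> f v) =
    2 * int (card {e \<in> negative_edges G \<sigma>. odd (f e)})] (mod 4)"
proof -
  have "(\<Sum>v\<in>vertices G. boundary G \<tau> f v) =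
      (\<Sum>e\<in>edges G. f e * (\<Sum>v\<in>vertices G. incidence \<tau> e v))"
    unfolding boundary_eq_net_flow net_flow_def sum_distrib_left by (rule sum.swap)
  also have "[\<dots> = (\<Sum>e\<in>edges G. if \<sigma> e = -1 \<and> odd (f e) then 2 else 0)] (mod 4)"
  proof (rule cong_sum)
    fix e assume e: "e \<in> edges G"
    obtain h h' where h: "h \<in> halfedges G" "h' \<in> halfedges G" "h \<noteq> h'"
      "edge_of G h = e" "edge_of G h' = e" "{k \<in> halfedges G. edge_of G k = e} = {h, h'}"
      using edge_halfedges[OF e] .
    have "(\<Sum>v\<in>vertices G. incidence \<tau> e v) = \<tau> h + \<tau> h'"
      unfolding incidence_eq_col[OF h(6,3)] col_def
      using h(1,2) finite_vertices end_of_in by (simp add: sum.distrib)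
    moreover have "\<tau> h \<in> {1, -1}" "\<tau> h' \<in> {1, -1}" "\<tau> h * \<tau> h' = - \<sigma> e"
      using or h unfolding orientation_def by auto
    ultimately have "(\<Sum>v\<in>vertices G. incidence \<tau> e v) = 0 \<and> \<sigma> e = 1 \<or>
        (\<Sum>v\<in>vertices G. incidence \<tau> e v) \<in> {2, -2} \<and> \<sigma> e = -1"
      by auto
    moreover have "[f e * 2 = (if odd (f e) then 2 else 0)] (mod 4)"
      "[f e * -2 = (if odd (f e) then 2 else 0)] (mod 4)"
      unfolding cong_iff_dvd_diff by (auto; presburger)+
    ultimately show "[f e * (\<Sum>v\<in>vertices G. incidence \<tau> e v) =
        (if \<sigma> e = -1 \<and> odd (f e) then 2 else 0)] (mod 4)"
      by auto
  qed
  also have "(\<Sum>e\<in>edges G. if \<sigma> e = -1 \<and> odd (f e) then 2 else 0) =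
      2 * int (card {e \<in> negative_edges G \<sigma>. odd (f e)})"
  proof -
    have "{e \<in> edges G. \<sigma> e = -1 \<and> odd (f e)} = {e \<in> negative_edges G \<sigma>. odd (f e)}"
      unfolding negative_edges_def by auto
    then show ?thesis
      using finite_edges by (simp flip: sum.inter_filter)
  qed
  finally show ?thesis .
qed

text \<open>A modulo 2-flow takes only the values -1, 0 and 1, so modulo 2 it is the indicator of
  its support.\<close>

lemma even_net_flow_support:
  assumes "modulo_flow G \<tau> 2 f" "v \<in> vertices G"
  shows "even (net_flow (flow_support G f) (incidence \<tau>) (\<lambda>_. 1) v)"
proof -
  let ?M = "\<lambda>e. incidence \<tau> e v"
  have "net_flow (flow_support G f) (incidence \<tau>) (\<lambda>_. 1) v =
      (\<Sum>e\<in>edges G. if f e \<noteq> 0 then ?M e else 0)"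
    unfolding net_flow_def flow_support_def by (simp add: sum.inter_filter finite_edges)
  also have "[\<dots> = (\<Sum>e\<in>edges G. f e * ?M e)] (mod 2)"
  proof (rule cong_sum)
    fix e assume "e \<in> edges G"
    then have "\<bar>f e\<bar> \<le> 1"
      using assms(1) unfolding modulo_flow_def by simp
    then have "f e = 0 \<or> f e = 1 \<or> f e = -1"
      by linarith
    then show "[(if f e \<noteq> 0 then ?M e else 0) = f e * ?M e] (mod 2)"
      by (auto simp: cong_iff_dvd_diff)
  qed
  also have "(\<Sum>e\<in>edges G. f e * ?M e) = boundary G \<tau> f v"
    by (simp add: boundary_eq_net_flow net_flow_def)
  also have "[boundary G \<tau> f v = 0] (mod 2)"
    using assms unfolding modulo_flow_def by simp
  finally show ?thesis
    by (simp add: cong_0_iff)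
qed

end

section \<open>The integer-valued 3-flow\<close>

theorem theorem1p4:
  fixes G :: "('v, 'e, 'h) multigraph"
    and \<sigma> :: "'e \<Rightarrow> int" and \<tau> :: "'h \<Rightarrow> int" and f\<^sub>1 :: "'e \<Rightarrow> int"
  assumes "finite_multigraph G"
    and "connected_multigraph G"
    and "signature G \<sigma>"
    and "orientation G \<sigma> \<tau>"
    and "modulo_flow G \<tau> 2 f\<^sub>1"
    and "even (card (flow_support G f\<^sub>1 \<inter> negative_edges G \<sigma>))"
  shows "\<exists>f\<^sub>2. integer_flow G \<tau> 3 f\<^sub>2 \<and>
    flow_support G f\<^sub>1 = {e \<in> edges G. f\<^sub>2 e = 1 \<or> f\<^sub>2 e = -1}"
proof -
  interpret finite_multigraph G by fact
  let ?H = "flow_support G f\<^sub>1"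
  obtain r where r: "r \<in> vertices G"
    using assms(2) unfolding connected_multigraph_def by blast
  obtain xs where att: "attached (joined (edges G) (incidence \<tau>)) r xs"
    and V: "insert r (set xs) = vertices G"
    using exists_attached_vertices[OF assms(4,2) r] by blast
  have "even_system r xs (edges G) (incidence \<tau>) ?H"
    unfolding even_system_def V
    using finite_edges att edge_column_incidence[OF assms(4)] even_net_flow_support[OF assms(5)]
    by (auto simp: flow_support_def)
  then obtain f where "solution r xs (edges G) (incidence \<tau>) ?H (\<lambda>_. 0) f"
    using even_system_solvable[of r xs "edges G" "incidence \<tau>" ?H "\<lambda>_. 0"] by auto
  then have f: "\<And>e. e \<in> edges G \<Longrightarrow> \<bar>f e\<bar> \<le> 2"
      "\<And>e. e \<in> edges G \<Longrightarrow> odd (f e) \<longleftrightarrow> e \<in> ?H"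
    and bd: "\<And>v. v \<in> vertices G \<Longrightarrow> boundary G \<tau> f v \<in> {-2, 0, 2}"
    and dvd: "\<And>v. v \<in> set xs \<Longrightarrow> 4 dvd boundary G \<tau> f v"
    unfolding solution_def V boundary_eq_net_flow by auto
  \<comment> \<open>Among -2, 0 and 2 only 0 is divisible by 4.\<close>
  have zero: "boundary G \<tau> f v = 0" if "v \<in> vertices G" "4 dvd boundary G \<tau> f v" for v
    using bd[OF that(1)] that(2) by auto
  have "boundary G \<tau> f v = 0" if "v \<in> vertices G - {r}" for v
    using that V dvd zero by blast
  then have "(\<Sum>v\<in>vertices G. boundary G \<tau> f v) = boundary G \<tau> f r"
    using sum.remove[OF finite_vertices r, of "boundary G \<tau> f"] by simp
  moreover have "{e \<in> negative_edges G \<sigma>. odd (f e)} = ?H \<inter> negative_edges G \<sigma>"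
    using f(2) unfolding negative_edges_def by auto
  ultimately have "[boundary G \<tau> f r = 2 * int (card (?H \<inter> negative_edges G \<sigma>))] (mod 4)"
    using sum_boundary_cong[OF assms(4), of f] by simp
  \<comment> \<open>This is where the even number of negative edges in the support enters.\<close>
  moreover have "4 dvd 2 * int (card (?H \<inter> negative_edges G \<sigma>))"
    using assms(6) by (elim evenE) simp
  ultimately have "4 dvd boundary G \<tau> f r"
    using cong_dvd_iff by blast
  then have "4 dvd boundary G \<tau> f v" if "v \<in> vertices G" for v
    using that V dvd by (cases "v = r") auto
  then have "boundary G \<tau> f v = 0" if "v \<in> vertices G" for v
    using that zero by simp
  then have "integer_flow G \<tau> 3 f"
    using f(1) unfolding integer_flow_def by simp
  moreover have "?H = {e \<in> edges G. f e = 1 \<or> f e = -1}"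
  proof -
    \<comment> \<open>The bound 2 turns oddness into absolute value 1, so parity on
      \<open>?H\<close> becomes the required description of the support.\<close>
    have odd_iff: "odd k \<longleftrightarrow> k = 1 \<or> k = -1" if "\<bar>k\<bar> \<le> 2" for k :: int
    proof -
      have "k = -2 \<or> k = -1 \<or> k = 0 \<or> k = 1 \<or> k = 2"
        using that by linarith
      then show ?thesis by auto
    qed
    have "e \<in> ?H \<longleftrightarrow> e \<in> edges G \<and> (f e = 1 \<or> f e = -1)" for e
    proof (cases "e \<in> edges G")
      case True
      then show ?thesis
        using f(2)[OF True] odd_iff[OF f(1)[OF True]] by simp
    qed (simp add: flow_support_def)
    then show ?thesis
      by blast
  qed
  ultimately show ?thesis
    by blast
qed

end
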